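(* For every $\pi\in G_{r,n}$, $$\sum_{j,k\ge 0}\binom{rjk+j+k+n-\mathrm{des}(\pi)}{n}s^jt^k=\frac{\sum_{\sigma\tau=\pi}s^{\mathrm{des}(\sigma)}t^{\mathrm{des}(\tau)}}{(1-s)^{n+1}(1-t)^{n+1}},$$ where the sum on the right is over all pairs $(\sigma,\tau)\in G_{r,n}\times G_{r,n}$ with $\sigma\tau=\pi$.
   Context: Let $r,n\ge 1$. Write $i_c$ for a letter $i$ with color $c\in\{0,1,\ldots,r-1\}$, and order colored letters by color first and then by value: $i_c<j_d$ iff $c<d$, or $c=d$ and $i<j$. The group $G_{r,n}$ of $r$-colored permutations is the group of all bijections $\pi$ of $\{i_c:1\le i\le n,\ 0\le c\le r-1\}$ such that $\pi(i_0)=k_l$ implies $\pi(i_a)=k_{l+a}$ for all $a$ (colors modulo $r$), under composition. Such $\pi$ is determined by, and identified with, the word $\pi(1)\cdots\pi(n)$ where $\pi(i):=\pi(i_0)$; in this notation if $\tau(i)=j_k$ and $\sigma(j)=l_p$ then $(\sigma\tau)(i)=l_{k+p}$, color taken mod $r$. The descent number $\mathrm{des}(\pi)$ is the number of $i\in\{1,\ldots,n\}$ with $\pi(i)>\pi(i+1)$, where by convention $\pi(n+1):=0_1$ (so $n$ is a descent if and only if the color of $\pi(n)$ is nonzero). The identity is one of formal power series in $s,t$. *)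

theory Defs
  imports "HOL-Computational_Algebra.Formal_Power_Series" "HOL-Combinatorics.Permutations"
begin

text \<open>A colored letter \<open>i\<^sub>c\<close> is the pair \<open>(i, c)\<close> of its value and its color.\<close>

type_synonym letter = "nat \<times> nat"

definition letters :: "nat \<Rightarrow> nat \<Rightarrow> letter set" where
  "letters r n = {1..n} \<times> {0..<r}"

definition letter_less :: "letter \<Rightarrow> letter \<Rightarrow> bool" where
  "letter_less x y \<longleftrightarrow> snd x < snd y \<or> (snd x = snd y \<and> fst x < fst y)"

text \<open>
  The group \<open>G\<^bsub>r,n\<^esub>\<close> under composition. As usual for \<^const>\<open>permutes\<close>, a bijection of the
  letters is extended by the identity to all pairs, so that equality of bijections of the
  letters is equality of functions.
\<close>

definition colored_perms :: "nat \<Rightarrow> nat \<Rightarrow> (letter \<Rightarrow> letter) set" where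
  "colored_perms r n = {\<pi>. \<pi> permutes letters r n \<and>
     (\<forall>i\<in>{1..n}. \<forall>k l. \<pi> (i, 0) = (k, l) \<longrightarrow> (\<forall>a<r. \<pi> (i, a) = (k, (l + a) mod r)))}"

text \<open>
  The word \<open>\<pi>(1) \<dots> \<pi>(n) \<pi>(n+1)\<close>, where \<open>\<pi>(n+1) = 0\<^sub>1\<close>. For \<open>r = 1\<close> the color of this last
  letter is not reduced modulo \<open>r\<close>, so that \<open>n\<close> is then never a descent.
\<close>

definition word :: "nat \<Rightarrow> (letter \<Rightarrow> letter) \<Rightarrow> nat \<Rightarrow> letter" where
  "word n \<pi> i = (if i = n + 1 then (0, 1) else \<pi> (i, 0))"

definition des :: "nat \<Rightarrow> (letter \<Rightarrow> letter) \<Rightarrow> nat" where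
  "des n \<pi> = card {i \<in> {1..n}. letter_less (word n \<pi> (i + 1)) (word n \<pi> i)}"

lemma finite_letters: "finite (letters r n)"
  by (simp add: letters_def)

lemma finite_colored_perms: "finite (colored_perms r n)"
  by (rule finite_subset[OF _ finite_permutations[OF finite_letters[of r n]]])
     (auto simp: colored_perms_def)

lemma finite_factorizations:
  "finite {(\<sigma>, \<tau>). \<sigma> \<in> colored_perms r n \<and> \<tau> \<in> colored_perms r n \<and> \<sigma> \<circ> \<tau> = \<pi>}"
  by (rule finite_subset[OF _ finite_cartesian_product[OF finite_colored_perms[of r n] finite_colored_perms[of r n]]])
     auto

lemma des_le: "des n \<pi> \<le> n"
  unfolding des_def by (rule order_trans[OF card_mono[of "{1..n}"]]) auto

text \<open>
  Power series in \<open>s\<close> and \<open>t\<close> are power series in \<open>s\<close> whose coefficients are power series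
  in \<open>t\<close>.
\<close>

definition var_s :: "rat fps fps" where "var_s = fps_X"

definition var_t :: "rat fps fps" where "var_t = fps_const fps_X"

text \<open>The formal sum of \<open>a j k \<cdot> s\<^sup>j t\<^sup>k\<close> over all \<open>j, k \<ge> 0\<close>.\<close>

definition double_series :: "(nat \<Rightarrow> nat \<Rightarrow> rat) \<Rightarrow> rat fps fps" where
  "double_series a = Abs_fps (\<lambda>j. Abs_fps (\<lambda>k. a j k))"

lemma nth_nth_monomial:
  "fps_nth (fps_nth (var_s ^ j * var_t ^ k) a) b = (if a = j \<and> b = k then 1 else 0)"
  by (simp add: var_s_def var_t_def fps_const_power fps_X_power_iff)

text \<open>
  The library defines division in nested power series rings, but most of its lemmas on it
  need coefficients in a field. The following one shows that it is the
  expected quotient here.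
\<close>

lemma divide_denominator:
  fixes f :: "rat fps fps" and m m' :: nat
  defines "d \<equiv> (1 - var_s) ^ m * (1 - var_t) ^ m'"
  shows "f / d * d = f"
proof -
  have c: "inverse (fps_nth d 0) * fps_nth d 0 = 1"
    by (rule inverse_mult_eq_1)
       (simp add: d_def var_s_def var_t_def fps_mult_nth fps_power_zeroth)
  then have nz: "fps_nth d 0 \<noteq> 0" by auto
  have "d * inverse d = 1"
    unfolding fps_inverse_def[of d] by (rule fps_right_inverse) (use c in \<open>simp only: mult.commute\<close>)
  then show ?thesis
    by (simp add: fps_divide_unit[OF nz] mult.assoc mult.commute[of _ d])
qed

end

theory Submission
  imports Defs "HOL-Library.Product_Lexorder"
begin

text \<open>
  Comparing coefficients of \<open>s\<^sup>j t\<^sup>k\<close>, the claim becomes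
  \<open>\<Sum>\<^bsub>\<sigma>\<tau>=\<pi>\<^esub> (j + n - des \<sigma> choose n) (k + n - des \<tau> choose n) = (rjk + j + k + n - des \<pi> choose n)\<close>.
  The number \<open>N + n - des \<pi> choose n\<close> counts the functions \<open>f : {1..n} \<rightarrow> {0..rN}\<close> sorted by \<open>\<pi>\<close>: ordering
  the numbers \<open>l\<close> by \<open>f l\<close>, with ties broken by \<open>l\<close>, and coloring \<open>l\<close> by \<open>f l mod r\<close> yields the
  word of \<open>\<pi>\<close>. If \<open>f\<close> and \<open>g\<close> are sorted by \<open>\<sigma>\<close> and \<open>\<tau>\<close>, then
  \<open>h l = (rj + 1) g (|\<sigma>|\<^sup>-\<^sup>1 l) + f l\<close> is sorted by \<open>\<sigma>\<tau>\<close>. As \<open>(rj + 1)(rk + 1) = r(rjk + j + k) + 1\<close>,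
  division with remainder by \<open>rj + 1\<close> recovers \<open>f\<close>, \<open>g\<close> and the factorization from \<open>h\<close>.
\<close>

section \<open>Power series\<close>

text \<open>Multiplying by \<open>1 - fps_X\<close> takes differences of consecutive coefficients,
  and by Pascal's rule this lowers \<open>n\<close> by one.\<close>

lemma binomial_series_mult:
  "Abs_fps (\<lambda>j. of_nat ((j + n) choose n) :: 'a::comm_ring_1) * (1 - fps_X) ^ (n + 1) = 1"
proof (induction n)
  case 0
  show ?case
    by (simp add: fps_eq_iff right_diff_distrib)
next
  case (Suc n)
  have "Abs_fps (\<lambda>j. of_nat ((j + Suc n) choose Suc n) :: 'a) * (1 - fps_X)
      = Abs_fps (\<lambda>j. of_nat ((j + n) choose n))"
  proof (rule fps_ext)
    fix m
    show "fps_nth (Abs_fps (\<lambda>j. of_nat ((j + Suc n) choose Suc n) :: 'a) * (1 - fps_X)) m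
      = fps_nth (Abs_fps (\<lambda>j. of_nat ((j + n) choose n))) m"
      by (cases m) (simp_all add: right_diff_distrib binomial_eq_0)
  qed
  moreover have "(1 - fps_X :: 'a fps) ^ (Suc n + 1) = (1 - fps_X) * (1 - fps_X) ^ (n + 1)"
    by simp
  ultimately show ?case
    using Suc by (simp only: mult.assoc[symmetric])
qed

text \<open>As \<open>p \<le> n\<close>, the subtraction is exact. The coefficients with
  \<open>j < p\<close> vanish, so the series is the previous one shifted by \<open>p\<close>
  places.\<close>

lemma shifted_binomial_series_mult:
  assumes "p \<le> n"
  shows "Abs_fps (\<lambda>j. of_nat ((j + n - p) choose n) :: 'a::comm_ring_1) * (1 - fps_X) ^ (n + 1)
    = fps_X ^ p"
proof -
  have "Abs_fps (\<lambda>j. of_nat ((j + n - p) choose n) :: 'a)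
      = fps_X ^ p * Abs_fps (\<lambda>j. of_nat ((j + n) choose n))"
    using assms by (intro fps_ext) (auto simp: fps_X_power_mult_nth binomial_eq_0)
  then show ?thesis
    using binomial_series_mult[of n, where 'a = 'a] by (simp add: mult.assoc)
qed

text \<open>The coefficients are products, so the series is one in \<open>s\<close> times one in
  \<open>t\<close>, and each factor cancels its own part of the denominator.\<close>

lemma double_series_binomials_mult:
  assumes "p \<le> n" "q \<le> n"
  shows "double_series (\<lambda>j k. of_nat ((j + n - p) choose n) * of_nat ((k + n - q) choose n))
    * ((1 - var_s) ^ (n + 1) * (1 - var_t) ^ (n + 1)) = var_s ^ p * var_t ^ q"
proof -
  define S :: "rat fps fps" where "S = Abs_fps (\<lambda>j. of_nat ((j + n - p) choose n))"
  define T :: "rat fps" where "T = Abs_fps (\<lambda>k. of_nat ((k + n - q) choose n))"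
  have "double_series (\<lambda>j k. of_nat ((j + n - p) choose n) * of_nat ((k + n - q) choose n))
      = S * fps_const T"
    by (intro fps_ext) (simp add: double_series_def S_def T_def fps_of_nat[symmetric])
  moreover have "S * (1 - var_s) ^ (n + 1) = var_s ^ p"
    unfolding S_def var_s_def by (rule shifted_binomial_series_mult[OF assms(1)])
  moreover have "fps_const T * (1 - var_t) ^ (n + 1) = var_t ^ q"
  proof -
    \<comment> \<open>\<open>fps_const\<close> is a ring homomorphism, so the computation can be
      done with plain series in \<open>t\<close>.\<close>
    have "fps_const T * (1 - var_t) ^ (n + 1) = fps_const (T * (1 - fps_X) ^ (n + 1))"
      by (simp add: var_t_def fps_const_power[symmetric] fps_const_mult[symmetric]
            fps_const_sub[symmetric] del: fps_const_power fps_const_mult fps_const_sub)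
    also have "T * (1 - fps_X) ^ (n + 1) = fps_X ^ q"
      unfolding T_def by (rule shifted_binomial_series_mult[OF assms(2)])
    finally show ?thesis
      by (simp add: var_t_def fps_const_power)
  qed
  ultimately show ?thesis
    by (metis mult.assoc mult.left_commute)
qed

section \<open>Colored permutations\<close>

text \<open>This is the uncolored permutation |\<pi>|. Together with \<open>col\<close> it splits
  the word of \<pi> into values and colors.\<close>

definition val :: "(letter \<Rightarrow> letter) \<Rightarrow> nat \<Rightarrow> nat" where
  "val \<pi> i = fst (\<pi> (i, 0))"

definition col :: "(letter \<Rightarrow> letter) \<Rightarrow> nat \<Rightarrow> nat" where
  "col \<pi> i = snd (\<pi> (i, 0))"

lemma colored_perms_apply:
  assumes "\<pi> \<in> colored_perms r n" "i \<in> {1..n}" "a < r"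
  shows "\<pi> (i, a) = (val \<pi> i, (col \<pi> i + a) mod r)"
  using assms by (auto simp: colored_perms_def val_def col_def)

lemma
  assumes "\<pi> \<in> colored_perms r n" "i \<in> {1..n}" "r \<ge> 1"
  shows val_in: "val \<pi> i \<in> {1..n}" and col_less: "col \<pi> i < r"
proof -
  have "\<pi> permutes letters r n" "(i, 0) \<in> letters r n"
    using assms by (simp_all add: colored_perms_def letters_def)
  then have "\<pi> (i, 0) \<in> letters r n"
    by (simp only: permutes_in_image)
  then show "val \<pi> i \<in> {1..n}" "col \<pi> i < r"
    by (auto simp: val_def col_def letters_def mem_Times_iff)
qed

text \<open>The letter that \<pi> sends to \<open>(l, 0)\<close> sits at a position with value
  \<open>l\<close>. So \<open>val \<pi>\<close> is onto, hence injective on a finite set.\<close>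

lemma bij_betw_val:
  assumes "\<pi> \<in> colored_perms r n" "r \<ge> 1"
  shows "bij_betw (val \<pi>) {1..n} {1..n}"
proof -
  have "val \<pi> ` {1..n} = {1..n}"
  proof (intro equalityI subsetI)
    fix l assume l: "l \<in> {1..n}"
    then have "(l, 0) \<in> \<pi> ` letters r n"
      using assms permutes_image[of \<pi> "letters r n"] by (auto simp: colored_perms_def letters_def)
    then obtain i a where "i \<in> {1..n}" "a < r" "\<pi> (i, a) = (l, 0)"
      by (auto simp: letters_def)
    with colored_perms_apply[OF assms(1), of i a] show "l \<in> val \<pi> ` {1..n}"
      by auto
  qed (use val_in[OF assms(1) _ assms(2)] in auto)
  then show ?thesis
    by (simp add: bij_betw_def eq_card_imp_inj_on)
qed

lemma colored_perms_eqI: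
  assumes "\<pi> \<in> colored_perms r n" "\<pi>' \<in> colored_perms r n"
    and "\<And>i. i \<in> {1..n} \<Longrightarrow> val \<pi> i = val \<pi>' i"
    and "\<And>i. i \<in> {1..n} \<Longrightarrow> col \<pi> i = col \<pi>' i"
  shows "\<pi> = \<pi>'"
proof
  fix x :: letter
  obtain i a where x: "x = (i, a)" by force
  show "\<pi> x = \<pi>' x"
  proof (cases "x \<in> letters r n")
    case True
    then show ?thesis
      using assms(3,4) colored_perms_apply[OF assms(1), of i a]
        colored_perms_apply[OF assms(2), of i a]
      by (simp add: x letters_def)
  next
    case False
    then show ?thesis
      using assms by (auto simp: colored_perms_def permutes_not_in)
  qed
qed

lemma add_mod_left_cancel:
  fixes a b c r :: nat
  assumes "(c + a) mod r = (c + b) mod r" "a < r" "b < r"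
  shows "a = b"
  using assms
proof (induction a b rule: linorder_wlog)
  case (le a b)
  then have "r dvd b - a"
    using mod_eq_dvd_iff_nat[of "c + a" "c + b" r] by simp
  then show ?case
    using le nat_dvd_not_less[of "b - a" r] by linarith
qed simp

text \<open>The word determines the images of all letters by shifting colors. The resulting map is
  injective on the finite set of letters, hence a bijection.\<close>

lemma colored_perms_exists:
  assumes p: "bij_betw p {1..n} {1..n}" and c: "\<And>i. i \<in> {1..n} \<Longrightarrow> c i < r"
  obtains \<pi> where "\<pi> \<in> colored_perms r n" "\<And>i. i \<in> {1..n} \<Longrightarrow> val \<pi> i = p i"
    "\<And>i. i \<in> {1..n} \<Longrightarrow> col \<pi> i = c i"
proof
  define \<pi> where
    "\<pi> = (\<lambda>(i, a). if (i, a) \<in> letters r n then (p i, (c i + a) mod r) else (i, a))"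
  have \<pi>: "\<pi> (i, a) = (p i, (c i + a) mod r)" if "i \<in> {1..n}" "a < r" for i a
    using that by (auto simp: \<pi>_def letters_def)
  have pos: "0 < r" if "i \<in> {1..n}" for i
    using c[OF that] by simp
  have pin: "p i \<in> {1..n}" if "i \<in> {1..n}" for i
    using bij_betwE[OF p] that by blast
  have inj: "inj_on \<pi> (letters r n)"
  proof (rule inj_onI)
    fix x y assume "x \<in> letters r n" "y \<in> letters r n" "\<pi> x = \<pi> y"
    moreover obtain i a j b where "x = (i, a)" "y = (j, b)" by force
    ultimately have *: "i \<in> {1..n}" "j \<in> {1..n}" "a < r" "b < r" "p i = p j"
      "(c i + a) mod r = (c j + b) mod r" "x = (i, a)" "y = (j, b)"
      using \<pi> by (auto simp: letters_def)
    then have "i = j"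
      using p by (auto simp: bij_betw_def dest: inj_onD)
    moreover have "a = b"
      using * \<open>i = j\<close> by (blast intro: add_mod_left_cancel)
    ultimately show "x = y"
      using * by simp
  qed
  have "\<pi> ` letters r n \<subseteq> letters r n"
    using pin pos by (force simp: \<pi>_def letters_def)
  then have "bij_betw \<pi> (letters r n) (letters r n)"
    using inj finite_letters by (simp add: bij_betw_def endo_inj_surj)
  then have "\<pi> permutes letters r n"
    by (rule bij_imp_permutes) (auto simp: \<pi>_def)
  then show "\<pi> \<in> colored_perms r n"
    using \<pi> c pos by (auto simp: colored_perms_def)
  show "val \<pi> i = p i" "col \<pi> i = c i" if "i \<in> {1..n}" for i
    using \<pi>[OF that pos[OF that]] c[OF that] by (auto simp: val_def col_def)
qed

lemma
  assumes "\<sigma> \<in> colored_perms r n" "\<tau> \<in> colored_perms r n" "r \<ge> 1" "i \<in> {1..n}"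
  shows val_comp: "val (\<sigma> \<circ> \<tau>) i = val \<sigma> (val \<tau> i)"
    and col_comp: "col (\<sigma> \<circ> \<tau>) i = (col \<sigma> (val \<tau> i) + col \<tau> i) mod r"
proof -
  have "\<tau> (i, 0) = (val \<tau> i, col \<tau> i)"
    by (simp add: val_def col_def)
  then have "(\<sigma> \<circ> \<tau>) (i, 0) = (val \<sigma> (val \<tau> i), (col \<sigma> (val \<tau> i) + col \<tau> i) mod r)"
    using colored_perms_apply[OF assms(1) val_in[OF assms(2,4,3)] col_less[OF assms(2,4,3)]]
    by simp
  then show "val (\<sigma> \<circ> \<tau>) i = val \<sigma> (val \<tau> i)"
    "col (\<sigma> \<circ> \<tau>) i = (col \<sigma> (val \<tau> i) + col \<tau> i) mod r"
    by (simp_all add: val_def[of "\<sigma> \<circ> \<tau>"] col_def[of "\<sigma> \<circ> \<tau>"])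
qed

lemma colored_perms_comp:
  assumes "\<sigma> \<in> colored_perms r n" "\<tau> \<in> colored_perms r n" "r \<ge> 1"
  shows "\<sigma> \<circ> \<tau> \<in> colored_perms r n"
proof -
  have "(\<sigma> \<circ> \<tau>) (i, a) = (val (\<sigma> \<circ> \<tau>) i, (col (\<sigma> \<circ> \<tau>) i + a) mod r)"
    if "i \<in> {1..n}" "a < r" for i a
    using that assms colored_perms_apply[OF assms(2) that]
      colored_perms_apply[OF assms(1) val_in[OF assms(2) that(1) assms(3)],
        of "(col \<tau> i + a) mod r"]
    by (simp add: val_comp[OF assms] col_comp[OF assms] mod_simps add.assoc)
  then have "\<forall>i\<in>{1..n}. \<forall>k l. (\<sigma> \<circ> \<tau>) (i, 0) = (k, l) \<longrightarrow>
      (\<forall>a<r. (\<sigma> \<circ> \<tau>) (i, a) = (k, (l + a) mod r))"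
    by (metis val_def col_def fst_conv snd_conv)
  moreover have "\<sigma> \<circ> \<tau> permutes letters r n"
    using assms by (intro permutes_compose) (auto simp: colored_perms_def)
  ultimately show ?thesis
    by (simp only: colored_perms_def mem_Collect_eq)
qed

section \<open>Sorting\<close>

lemma ex_sorting_bij:
  fixes key :: "nat \<Rightarrow> 'a::linorder"
  assumes "inj_on key {1..n}"
  obtains p where "bij_betw p {1..n} {1..n}" "strict_mono_on {1..n} (key \<circ> p)"
proof
  define xs where "xs = sort_key key [1..<Suc n]"
  \<comment> \<open>List indices start at 0, positions at 1.\<close>
  define p where "p = (\<lambda>i. xs ! (i - 1))"
  have len: "length xs = n" and set: "set xs = {1..n}" and dist: "distinct xs"
    by (auto simp: xs_def)
  have "bij_betw (\<lambda>i. i - 1) {1..n} {..<n}"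
    by (rule bij_betw_byWitness[where f' = Suc]) auto
  moreover have "bij_betw ((!) xs) {..<n} {1..n}"
    using bij_betw_nth[OF dist, of "{..<n}"] len set by simp
  ultimately show bij: "bij_betw p {1..n} {1..n}"
    using bij_betw_trans by (fastforce simp: p_def comp_def)
  show "strict_mono_on {1..n} (key \<circ> p)"
  proof (rule strict_mono_onI)
    fix i j assume ij: "i \<in> {1..n}" "j \<in> {1..n}" "i < j"
    have "sorted (map key xs)"
      by (simp add: xs_def)
    then have "key (p i) \<le> key (p j)"
      using ij len by (auto simp: p_def sorted_iff_nth_mono_less)
    moreover have "p i \<noteq> p j" "p i \<in> {1..n}" "p j \<in> {1..n}"
      using bij ij by (auto simp: bij_betw_def dest: inj_onD)
    ultimately show "(key \<circ> p) i < (key \<circ> p) j"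
      using assms by (auto simp: order_less_le dest: inj_onD)
  qed
qed

lemma sorting_bij_unique:
  fixes key :: "nat \<Rightarrow> 'a::linorder"
  assumes "inj_on key {1..n}"
    and "bij_betw p {1..n} {1..n}" "strict_mono_on {1..n} (key \<circ> p)"
    and "bij_betw q {1..n} {1..n}" "strict_mono_on {1..n} (key \<circ> q)"
    and "i \<in> {1..n}"
  shows "p i = q i"
proof -
  have sorted: "sorted_wrt (<) (map (key \<circ> p) [1..<Suc n])"
    if "strict_mono_on {1..n} (key \<circ> p)" for p
    using that by (auto simp: sorted_wrt_iff_nth_less strict_mono_on_def simp del: upt_Suc)
  have set: "set (map (key \<circ> p) [1..<Suc n]) = key ` {1..n}"
    if "bij_betw p {1..n} {1..n}" for p
    using that
    by (simp only: set_map set_upt image_comp[symmetric] atLeastLessThanSuc_atLeastAtMost bij_betw_def)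
  have "map (key \<circ> p) [1..<Suc n] = map (key \<circ> q) [1..<Suc n]"
    using sorted[OF assms(3)] sorted[OF assms(5)] set[OF assms(2)] set[OF assms(4)]
    by (intro strict_sorted_equal) auto
  moreover have "i \<in> set [1..<Suc n]"
    using assms(6) by (auto simp del: upt_Suc)
  ultimately have "key (p i) = key (q i)"
    by (metis map_eq_conv comp_apply)
  then show ?thesis
    using bij_betwE[OF assms(2)] bij_betwE[OF assms(4)] assms(1,6) by (blast dest: inj_onD)
qed

text \<open>In terms of \<open>P\<close>-partitions, \<open>f l\<close> merges a level \<open>f l div r\<close> and a color \<open>f l mod r\<close>.\<close>

definition sorts :: "nat \<Rightarrow> nat \<Rightarrow> (letter \<Rightarrow> letter) \<Rightarrow> (nat \<Rightarrow> nat) \<Rightarrow> bool" where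
  "sorts r n \<pi> f \<longleftrightarrow> (\<forall>i\<in>{1..n}. col \<pi> i = f (val \<pi> i) mod r) \<and>
    strict_mono_on {1..n} (\<lambda>i. (f (val \<pi> i), val \<pi> i))"

text \<open>The second component of the key \<open>(f l, l)\<close> makes it injective, so sorting
  by it gives a permutation; the colors are then prescribed by \<open>f\<close>. With
  \<open>sorts_unique\<close>, every \<open>f\<close> belongs to exactly one colored
  permutation.\<close>

lemma sorts_exists:
  assumes "r \<ge> 1"
  obtains \<pi> where "\<pi> \<in> colored_perms r n" "sorts r n \<pi> f"
proof -
  have "inj_on (\<lambda>l. (f l, l)) {1..n}"
    by (auto intro: inj_onI)
  then obtain p where p: "bij_betw p {1..n} {1..n}" "strict_mono_on {1..n} ((\<lambda>l. (f l, l)) \<circ> p)"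
    by (rule ex_sorting_bij)
  have "f (p i) mod r < r" for i
    using assms by simp
  then obtain \<pi> where "\<pi> \<in> colored_perms r n" "\<And>i. i \<in> {1..n} \<Longrightarrow> val \<pi> i = p i"
    "\<And>i. i \<in> {1..n} \<Longrightarrow> col \<pi> i = f (p i) mod r"
    using colored_perms_exists[OF p(1), of "\<lambda>i. f (p i) mod r" r] by metis
  with p(2) that show thesis
    by (simp add: sorts_def strict_mono_on_def)
qed

lemma sorts_unique:
  assumes "r \<ge> 1" "\<pi> \<in> colored_perms r n" "\<pi>' \<in> colored_perms r n"
    and "sorts r n \<pi> f" "sorts r n \<pi>' f"
  shows "\<pi> = \<pi>'"
proof -
  have inj: "inj_on (\<lambda>l. (f l, l)) {1..n}"
    by (auto intro: inj_onI)
  have mono: "strict_mono_on {1..n} ((\<lambda>l. (f l, l)) \<circ> val \<rho>)" if "sorts r n \<rho> f" for \<rho>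
    using that by (simp add: sorts_def comp_def)
  have "val \<pi> i = val \<pi>' i" if "i \<in> {1..n}" for i
    by (rule sorting_bij_unique[OF inj bij_betw_val[OF assms(2,1)] mono[OF assms(4)]
          bij_betw_val[OF assms(3,1)] mono[OF assms(5)] that])
  then show ?thesis
    using assms by (intro colored_perms_eqI) (auto simp: sorts_def)
qed

text \<open>The color condition survives because \<open>r * j + 1\<close> is congruent to 1 modulo \<open>r\<close>.\<close>

lemma sorts_comp:
  assumes "r \<ge> 1" and \<sigma>: "\<sigma> \<in> colored_perms r n" and \<tau>: "\<tau> \<in> colored_perms r n"
    and f: "sorts r n \<sigma> f" and g: "sorts r n \<tau> g"
    and fle: "\<And>l. l \<in> {1..n} \<Longrightarrow> f l \<le> r * j"
    and h: "\<And>m. m \<in> {1..n} \<Longrightarrow> h (val \<sigma> m) = (r * j + 1) * g m + f (val \<sigma> m)"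
  shows "sorts r n (\<sigma> \<circ> \<tau>) h"
  unfolding sorts_def
proof (intro conjI ballI strict_mono_onI)
  note comp = val_comp[OF \<sigma> \<tau> assms(1)] col_comp[OF \<sigma> \<tau> assms(1)]
  note in_\<tau> = val_in[OF \<tau> _ assms(1)] and in_\<sigma> = val_in[OF \<sigma> _ assms(1)]
  {
    fix i assume i: "i \<in> {1..n}"
    have "h (val \<sigma> (val \<tau> i)) = r * (j * g (val \<tau> i)) + (f (val \<sigma> (val \<tau> i)) + g (val \<tau> i))"
      using h[OF in_\<tau>[OF i]] by (simp add: algebra_simps)
    then have "h (val \<sigma> (val \<tau> i)) mod r = (f (val \<sigma> (val \<tau> i)) + g (val \<tau> i)) mod r"
      by simp
    then show "col (\<sigma> \<circ> \<tau>) i = h (val (\<sigma> \<circ> \<tau>) i) mod r"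
      using f g i in_\<tau>[OF i] by (simp add: comp sorts_def mod_add_eq)
  }
  fix i i' assume i: "i \<in> {1..n}" "i' \<in> {1..n}" "i < i'"
  define m m' where "m = val \<tau> i" and "m' = val \<tau> i'"
  have m: "m \<in> {1..n}" "m' \<in> {1..n}"
    using i in_\<tau> by (auto simp: m_def m'_def)
  have "(g m, m) < (g m', m')"
    using g i by (auto simp: sorts_def m_def m'_def strict_mono_on_def)
  then consider "g m < g m'" | "g m = g m'" "m < m'"
    by fastforce
  then have "(h (val \<sigma> m), val \<sigma> m) < (h (val \<sigma> m'), val \<sigma> m')"
  proof cases
    case 1
    \<comment> \<open>In base \<open>r * j + 1\<close> the leading part \<open>g\<close> decides:
      the remainder \<open>f \<le> r * j\<close> cannot reach the next multiple.\<close>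
    have "h (val \<sigma> m) < (r * j + 1) * Suc (g m)"
      using h[OF m(1)] fle[OF in_\<sigma>[OF m(1)]] by simp
    also have "\<dots> \<le> (r * j + 1) * g m'"
      using 1 by (intro mult_le_mono) auto
    also have "\<dots> \<le> h (val \<sigma> m')"
      using h[OF m(2)] by simp
    finally show ?thesis by simp
  next
    case 2
    \<comment> \<open>For equal leading parts \<open>h\<close> and \<open>f\<close> differ by the
      same constant at both places, so the order that \<sigma> gives to \<open>m < m'\<close>
      carries over, ties included.\<close>
    have "(f (val \<sigma> m), val \<sigma> m) < (f (val \<sigma> m'), val \<sigma> m')"
      using f m 2 by (auto simp: sorts_def strict_mono_on_def)
    then show ?thesis
      using h[OF m(1)] h[OF m(2)] 2 by auto
  qed
  then show "(h (val (\<sigma> \<circ> \<tau>) i), val (\<sigma> \<circ> \<tau>) i) < (h (val (\<sigma> \<circ> \<tau>) i'), val (\<sigma> \<circ> \<tau>) i')"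
    using i by (simp add: comp m_def m'_def)
qed

section \<open>Counting\<close>

text \<open>A shifted hockey-stick identity, by Pascal's rule.\<close>

lemma sum_shifted_binomial:
  assumes "D \<le> n"
  shows "(\<Sum>v<M. (v + n - D) choose n) = (M + n - D) choose (Suc n)"
proof (induction M)
  case (Suc M)
  have "Suc M + n - D = Suc (M + n - D)"
    using assms by simp
  with Suc show ?case by simp
qed (simp add: binomial_eq_0)

text \<open>For \<open>d i\<close> in {0, 1} these are weakly increasing sequences bounded by
  \<open>N\<close>, with a strict step after each \<open>i\<close> where \<open>d i = 1\<close>. The
  bound \<open>N\<close> acts as an entry following the last one.\<close>

definition gap_seqs :: "(nat \<Rightarrow> nat) \<Rightarrow> nat \<Rightarrow> nat \<Rightarrow> (nat \<Rightarrow> nat) set" where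
  "gap_seqs d n N = {y \<in> extensional {..<n}. \<forall>i<n. y i + d i \<le> (if Suc i = n then N else y (Suc i))}"

text \<open>The last entry \<open>v\<close> ranges over \<open>v + d n \<le> N\<close> and then
  takes over the role of the bound for the entries before it.\<close>

lemma gap_seqs_Suc:
  "bij_betw (\<lambda>(v, y). y(n := v)) (Sigma {..<N + 1 - d n} (gap_seqs d n)) (gap_seqs d (Suc n) N)"
proof (rule bij_betw_byWitness[where f' = "\<lambda>y. (y n, y(n := undefined))"])
  show "(\<lambda>(v, y). y(n := v)) ` Sigma {..<N + 1 - d n} (gap_seqs d n) \<subseteq> gap_seqs d (Suc n) N"
    by (auto simp: gap_seqs_def extensional_def less_Suc_eq split: if_splits)
  show "(\<lambda>y. (y n, y(n := undefined))) ` gap_seqs d (Suc n) N \<subseteq> Sigma {..<N + 1 - d n} (gap_seqs d n)"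
    by (auto simp: gap_seqs_def extensional_def less_Suc_eq split: if_splits)
qed (auto simp: gap_seqs_def extensional_def fun_eq_iff)

text \<open>Induction on \<open>n\<close> for all bounds at once: summing over the last entry gives
  a hockey-stick sum.\<close>

lemma card_gap_seqs:
  assumes "\<And>i. i < n \<Longrightarrow> d i \<le> 1"
  shows "finite (gap_seqs d n N) \<and> card (gap_seqs d n N) = (N + n - (\<Sum>i<n. d i)) choose n"
  using assms
proof (induction n arbitrary: N)
  case 0
  have "gap_seqs d 0 N = {\<lambda>_. undefined}"
    by (auto simp: gap_seqs_def extensional_def)
  then show ?case by simp
next
  case (Suc n)
  then have IH: "finite (gap_seqs d n v)"
    "card (gap_seqs d n v) = (v + n - (\<Sum>i<n. d i)) choose n" for v
    by simp_all
  have le: "(\<Sum>i<n. d i) \<le> n"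
    using sum_bounded_above[of "{..<n}" d 1] Suc.prems by simp
  have "card (gap_seqs d (Suc n) N) = (\<Sum>v<N + 1 - d n. (v + n - (\<Sum>i<n. d i)) choose n)"
    using bij_betw_same_card[OF gap_seqs_Suc[where N = N and d = d and n = n]] IH by simp
  also have "\<dots> = (N + 1 - d n + n - (\<Sum>i<n. d i)) choose (Suc n)"
    by (rule sum_shifted_binomial[OF le])
  \<comment> \<open>\<open>d n \<le> 1\<close> ensures that \<open>N + 1 - d n\<close> is not
    truncated.\<close>
  also have "N + 1 - d n + n - (\<Sum>i<n. d i) = N + Suc n - (\<Sum>i<Suc n. d i)"
    using Suc.prems[of n] by simp
  finally show ?case
    using bij_betw_finite[OF gap_seqs_Suc[where N = N and d = d and n = n]] IH by simp
qed

text \<open>Positions are counted from 0 here, but from 1 in \<^const>\<open>word\<close>.\<close>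

definition descent :: "nat \<Rightarrow> (letter \<Rightarrow> letter) \<Rightarrow> nat \<Rightarrow> nat" where
  "descent n \<pi> i = of_bool (letter_less (word n \<pi> (Suc (Suc i))) (word n \<pi> (Suc i)))"

lemma sum_descent: "(\<Sum>i<n. descent n \<pi> i) = des n \<pi>"
proof -
  have "(\<Sum>i<n. descent n \<pi> i) =
      card ({..<n} \<inter> {i. letter_less (word n \<pi> (Suc (Suc i))) (word n \<pi> (Suc i))})"
    by (simp add: descent_def of_bool_def sum.If_cases)
  also have "\<dots> = des n \<pi>"
    unfolding des_def
    by (rule bij_betw_same_card[of Suc], rule bij_betw_byWitness[where f' = "\<lambda>i. i - 1"]) auto
  finally show ?thesis .
qed

section \<open>Sorted functions as gap sequences\<close>

text \<open>Different levels \<open>y\<close>, \<open>y'\<close> decide the comparison. Equal levels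
  leave color, then value, which is the order of letters; since \<open>l \<noteq> l'\<close>, the
  comparison then fails exactly at a descent.\<close>

lemma pair_less_iff:
  fixes y y' c c' l l' r :: nat
  assumes "c < r" "c' < r" "l \<noteq> l'"
  shows "(r * y + c, l) < (r * y' + c', l') \<longleftrightarrow> y + of_bool (letter_less (l', c') (l, c)) \<le> y'"
proof -
  have "r * y + c < r * y' + c'" if "y < y'"
  proof -
    have "r * y + c < r * Suc y"
      using assms by simp
    also have "\<dots> \<le> r * y'"
      using that by (intro mult_le_mono) auto
    finally show ?thesis by simp
  qed
  moreover have "r * y' + c' < r * y + c" if "y' < y"
  proof -
    have "r * y' + c' < r * Suc y'"
      using assms by simp
    also have "\<dots> \<le> r * y"
      using that by (intro mult_le_mono) auto
    finally show ?thesis by simp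
  qed
  ultimately show ?thesis
    using assms(3) by (cases y y' rule: linorder_cases) (auto simp: letter_less_def less_prod_simp)
qed

text \<open>This is where the convention of a final letter \<open>(0, 1)\<close> enters: it lies
  below \<open>(l, c)\<close> iff \<open>c > 0\<close>, and a positive remainder \<open>c\<close>
  forces \<open>y < N\<close>.\<close>

lemma le_multiple_iff:
  fixes y c l r N :: nat
  assumes "c < r" "l \<ge> 1"
  shows "r * y + c \<le> r * N \<longleftrightarrow> y + of_bool (letter_less (0, 1) (l, c)) \<le> N"
proof -
  have "letter_less (0, 1) (l, c) \<longleftrightarrow> 0 < c"
    using assms(2) by (auto simp: letter_less_def)
  moreover have "r * y + c \<le> r * N \<longleftrightarrow> y \<le> N" if "c = 0"
    using that assms by simp
  moreover have "r * y + c \<le> r * N \<longleftrightarrow> y < N" if "c > 0"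
  proof
    assume "r * y + c \<le> r * N"
    then have "r * y < r * N" using that by linarith
    then show "y < N" by simp
  next
    assume "y < N"
    then have "r * Suc y \<le> r * N" by (intro mult_le_mono) auto
    then show "r * y + c \<le> r * N" using assms by simp
  qed
  ultimately show ?thesis by auto
qed

lemma strict_mono_on_atLeastAtMost_iff:
  fixes F :: "nat \<Rightarrow> 'a::order"
  shows "strict_mono_on {1..n} F \<longleftrightarrow> (\<forall>i<n. Suc i < n \<longrightarrow> F (Suc i) < F (Suc (Suc i)))"
proof
  assume step: "\<forall>i<n. Suc i < n \<longrightarrow> F (Suc i) < F (Suc (Suc i))"
  have "F i < F j" if "i < j" "1 \<le> i" "j \<le> n" for i j
    using that
  proof (induction i j rule: less_Suc_induct)
    case (1 i)
    then show ?case
      using step by (cases i) auto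
  next
    case (2 i j k)
    then have "F i < F j" "F j < F k" by auto
    then show ?case by (rule less_trans)
  qed
  then show "strict_mono_on {1..n} F"
    by (simp add: strict_mono_on_def)
qed (auto simp: strict_mono_on_def)

text \<open>With \<open>y\<close> as the levels of \<open>f\<close> along \<pi>, sortedness reduces
  to adjacent positions and, for sorted \<open>f\<close>, the bound reduces to the last position.
  Each of these conditions is one gap inequality, with gap 1 exactly at the descents.\<close>

lemma sorted_bounded_iff_gaps:
  assumes \<pi>: "\<pi> \<in> colored_perms r n" and r: "r \<ge> 1"
    and f: "\<And>i. i < n \<Longrightarrow> f (val \<pi> (Suc i)) = r * y i + col \<pi> (Suc i)"
  shows "strict_mono_on {1..n} (\<lambda>i. (f (val \<pi> i), val \<pi> i)) \<and> (\<forall>l\<in>{1..n}. f l \<le> r * N) \<longleftrightarrow>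
    (\<forall>i<n. y i + descent n \<pi> i \<le> (if Suc i = n then N else y (Suc i)))"
    (is "?mono \<and> ?bound \<longleftrightarrow> ?gaps")
proof -
  note bij = bij_betw_val[OF \<pi> r]
  have image: "{1..n} = val \<pi> ` {1..n}"
    using bij by (simp add: bij_betw_def)
  have bound: "?bound \<longleftrightarrow> (\<forall>i<n. Suc i = n \<longrightarrow> f (val \<pi> (Suc i)) \<le> r * N)" if ?mono
  proof
    assume ?bound
    then show "\<forall>i<n. Suc i = n \<longrightarrow> f (val \<pi> (Suc i)) \<le> r * N"
      using val_in[OF \<pi> _ r] by auto
  next
    assume last: "\<forall>i<n. Suc i = n \<longrightarrow> f (val \<pi> (Suc i)) \<le> r * N"
    have "f (val \<pi> i) \<le> r * N" if i: "i \<in> {1..n}" for i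
    proof -
      have "f (val \<pi> i) \<le> f (val \<pi> n)"
        using strict_mono_onD[OF \<open>?mono\<close> i, of n] i by (cases "i = n") auto
      also have "\<dots> \<le> r * N"
        using last i by (cases n) auto
      finally show ?thesis .
    qed
    then show ?bound
      by (subst image) blast
  qed
  have step: "(f (val \<pi> (Suc i)), val \<pi> (Suc i)) < (f (val \<pi> (Suc (Suc i))), val \<pi> (Suc (Suc i)))
      \<longleftrightarrow> y i + descent n \<pi> i \<le> y (Suc i)" if "i < n" "Suc i < n" for i
  proof -
    have "val \<pi> (Suc i) \<noteq> val \<pi> (Suc (Suc i))"
      using bij that by (auto simp: bij_betw_def dest: inj_onD)
    then show ?thesis
      using that f col_less[OF \<pi> _ r] pair_less_iff[of "col \<pi> (Suc i)" r "col \<pi> (Suc (Suc i))"]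
      by (simp add: descent_def word_def val_def col_def)
  qed
  have final: "f (val \<pi> (Suc i)) \<le> r * N \<longleftrightarrow> y i + descent n \<pi> i \<le> N"
    if "i < n" "Suc i = n" for i
    using that f[of i] val_in[OF \<pi> _ r, of "Suc i"] col_less[OF \<pi> _ r, of "Suc i"]
      le_multiple_iff[of "col \<pi> (Suc i)" r "val \<pi> (Suc i)" "y i" N]
    by (simp add: descent_def word_def val_def col_def)
  let ?less = "\<lambda>i. (f (val \<pi> (Suc i)), val \<pi> (Suc i)) < (f (val \<pi> (Suc (Suc i))), val \<pi> (Suc (Suc i)))"
  have gap: "(y i + descent n \<pi> i \<le> (if Suc i = n then N else y (Suc i))) \<longleftrightarrow>
      (Suc i < n \<longrightarrow> ?less i) \<and> (Suc i = n \<longrightarrow> f (val \<pi> (Suc i)) \<le> r * N)" if "i < n" for i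
  proof (cases "Suc i = n")
    case True
    then show ?thesis
      using final[OF that True] by simp
  next
    case False
    then have "Suc i < n"
      using that by simp
    with False show ?thesis
      unfolding step[OF that \<open>Suc i < n\<close>] by simp
  qed
  have "?mono \<and> ?bound \<longleftrightarrow> ?mono \<and> (\<forall>i<n. Suc i = n \<longrightarrow> f (val \<pi> (Suc i)) \<le> r * N)"
    using bound by blast
  also have "\<dots> \<longleftrightarrow> ?gaps"
    unfolding strict_mono_on_atLeastAtMost_iff using gap by blast
  finally show ?thesis .
qed

definition sorted_fns :: "nat \<Rightarrow> nat \<Rightarrow> (letter \<Rightarrow> letter) \<Rightarrow> nat \<Rightarrow> (nat \<Rightarrow> nat) set" where
  "sorted_fns r n \<pi> N = {f \<in> {1..n} \<rightarrow>\<^sub>E {..r * N}. sorts r n \<pi> f}"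

text \<open>The residues of \<open>f\<close> modulo \<open>r\<close> are dictated by the colors of
  \<pi>, so \<open>f\<close> amounts to its levels, read in the order of positions.\<close>

lemma bij_betw_sorted_fns_gap_seqs:
  assumes \<pi>: "\<pi> \<in> colored_perms r n" and r: "r \<ge> 1"
  shows "bij_betw (\<lambda>f. \<lambda>i\<in>{..<n}. f (val \<pi> (Suc i)) div r)
    (sorted_fns r n \<pi> N) (gap_seqs (descent n \<pi>) n N)"
proof -
  define F where "F = (\<lambda>f. \<lambda>i\<in>{..<n}. f (val \<pi> (Suc i)) div r)"
  define pos where "pos = inv_into {1..n} (val \<pi>)"
  \<comment> \<open>The inverse puts level and color back together at each value;
    \<open>pos l - 1\<close> converts to positions counted from 0.\<close>
  define G where "G = (\<lambda>y. \<lambda>l\<in>{1..n}. r * y (pos l - 1) + col \<pi> (pos l))"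
  note bij = bij_betw_val[OF \<pi> r]
  have pos_val: "pos (val \<pi> i) = i" if "i \<in> {1..n}" for i
    using bij that by (simp add: pos_def bij_betw_inv_into_left)
  have val_pos: "val \<pi> (pos l) = l" if "l \<in> {1..n}" for l
    using bij that by (simp add: pos_def bij_betw_inv_into_right)
  have pos_in: "pos l \<in> {1..n}" if "l \<in> {1..n}" for l
    using bij_betwE[OF bij_betw_inv_into[OF bij]] that by (simp add: pos_def)
  have G: "G y (val \<pi> (Suc i)) = r * y i + col \<pi> (Suc i)" if "i < n" for y i
    using that val_in[OF \<pi> _ r, of "Suc i"] pos_val[of "Suc i"] by (simp add: G_def)
  have F: "f (val \<pi> (Suc i)) = r * F f i + col \<pi> (Suc i)" if "sorts r n \<pi> f" "i < n" for f i
    using that by (simp add: F_def sorts_def)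
  have "bij_betw F (sorted_fns r n \<pi> N) (gap_seqs (descent n \<pi>) n N)"
  proof (rule bij_betw_byWitness[where f' = G])
    show "\<forall>f\<in>sorted_fns r n \<pi> N. G (F f) = f"
    proof
      fix f assume f: "f \<in> sorted_fns r n \<pi> N"
      have "G (F f) l = f l" if "l \<in> {1..n}" for l
      proof -
        have "pos l - 1 < n" "Suc (pos l - 1) = pos l"
          using pos_in[OF that] by auto
        then show ?thesis
          using F[of f "pos l - 1"] f that val_pos[OF that] by (simp add: G_def sorted_fns_def)
      qed
      then show "G (F f) = f"
        using f by (intro extensionalityI[of _ "{1..n}"])
          (auto simp: G_def sorted_fns_def PiE_def)
    qed
    show "\<forall>y\<in>gap_seqs (descent n \<pi>) n N. F (G y) = y"
    proof
      fix y assume y: "y \<in> gap_seqs (descent n \<pi>) n N"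
      have "F (G y) i = y i" if "i < n" for i
        using G[OF that] that col_less[OF \<pi> _ r, of "Suc i"] by (simp add: F_def)
      then show "F (G y) = y"
        using y by (intro extensionalityI[of _ "{..<n}"]) (auto simp: F_def gap_seqs_def)
    qed
    show "F ` sorted_fns r n \<pi> N \<subseteq> gap_seqs (descent n \<pi>) n N"
    proof
      fix y assume "y \<in> F ` sorted_fns r n \<pi> N"
      then obtain f where f: "f \<in> {1..n} \<rightarrow>\<^sub>E {..r * N}" "sorts r n \<pi> f" and y: "y = F f"
        by (auto simp: sorted_fns_def)
      have "\<forall>i<n. F f i + descent n \<pi> i \<le> (if Suc i = n then N else F f (Suc i))"
        using f by (intro sorted_bounded_iff_gaps[OF \<pi> r F, THEN iffD1])
          (auto simp: sorts_def)
      moreover have "F f \<in> extensional {..<n}"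
        by (simp add: F_def)
      ultimately show "y \<in> gap_seqs (descent n \<pi>) n N"
        by (simp add: y gap_seqs_def)
    qed
    show "G ` gap_seqs (descent n \<pi>) n N \<subseteq> sorted_fns r n \<pi> N"
    proof
      fix f assume "f \<in> G ` gap_seqs (descent n \<pi>) n N"
      then obtain y where y: "y \<in> gap_seqs (descent n \<pi>) n N" and f: "f = G y"
        by blast
      have "strict_mono_on {1..n} (\<lambda>i. (G y (val \<pi> i), val \<pi> i)) \<and> (\<forall>l\<in>{1..n}. G y l \<le> r * N)"
        using y by (intro sorted_bounded_iff_gaps[OF \<pi> r G, THEN iffD2]) (auto simp: gap_seqs_def)
      moreover have "col \<pi> i = G y (val \<pi> i) mod r" if "i \<in> {1..n}" for i
        using G[of "i - 1" y] that col_less[OF \<pi> that r] by (cases i) auto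
      ultimately show "f \<in> sorted_fns r n \<pi> N"
        by (auto simp: f sorted_fns_def sorts_def G_def)
    qed
  qed
  then show ?thesis
    by (simp add: F_def)
qed

lemma
  assumes "\<pi> \<in> colored_perms r n" "r \<ge> 1"
  shows finite_sorted_fns: "finite (sorted_fns r n \<pi> N)"
    and card_sorted_fns: "card (sorted_fns r n \<pi> N) = (N + n - des n \<pi>) choose n"
proof -
  have "finite (gap_seqs (descent n \<pi>) n N) \<and>
      card (gap_seqs (descent n \<pi>) n N) = (N + n - des n \<pi>) choose n"
    unfolding sum_descent[symmetric] by (rule card_gap_seqs) (simp add: descent_def)
  then show "finite (sorted_fns r n \<pi> N)" "card (sorted_fns r n \<pi> N) = (N + n - des n \<pi>) choose n"
    using bij_betw_same_card[OF bij_betw_sorted_fns_gap_seqs[OF assms]]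
      bij_betw_finite[OF bij_betw_sorted_fns_gap_seqs[OF assms]] by metis+
qed

section \<open>Merging pairs of sorted functions\<close>

definition factorizations :: "nat \<Rightarrow> nat \<Rightarrow> (letter \<Rightarrow> letter) \<Rightarrow> ((letter \<Rightarrow> letter) \<times> (letter \<Rightarrow> letter)) set"
  where "factorizations r n \<pi> =
    {(\<sigma>, \<tau>). \<sigma> \<in> colored_perms r n \<and> \<tau> \<in> colored_perms r n \<and> \<sigma> \<circ> \<tau> = \<pi>}"

text \<open>The function \<open>h\<close> built from \<open>f\<close> and \<open>g\<close>, with
  base \<open>b\<close> in place of \<open>r * j + 1\<close>; the \<open>inv_into\<close> term is
  the inverse of |\<sigma>|.\<close>

definition merge :: "nat \<Rightarrow> nat \<Rightarrow> (letter \<Rightarrow> letter) \<Rightarrow> (nat \<Rightarrow> nat) \<Rightarrow> (nat \<Rightarrow> nat) \<Rightarrow> nat \<Rightarrow> nat" where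
  "merge b n \<sigma> f g = (\<lambda>l\<in>{1..n}. b * g (inv_into {1..n} (val \<sigma>) l) + f l)"

lemma
  assumes "\<sigma> \<in> colored_perms r n" "r \<ge> 1" "m \<in> {1..n}"
  shows merge_val: "merge b n \<sigma> f g (val \<sigma> m) = b * g m + f (val \<sigma> m)"
  using bij_betw_inv_into_left[OF bij_betw_val[OF assms(1,2)] assms(3)] val_in[OF assms(1,3,2)]
  by (simp add: merge_def)

text \<open>Sortedness is \<open>sorts_comp\<close>. The bound is the largest number with quotient
  \<open>r * k\<close> and remainder \<open>r * j\<close>.\<close>

lemma merge_in_sorted_fns:
  assumes r: "r \<ge> 1" and "(\<sigma>, \<tau>) \<in> factorizations r n \<pi>"
    and "f \<in> sorted_fns r n \<sigma> j" "g \<in> sorted_fns r n \<tau> k"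
  shows "merge (r * j + 1) n \<sigma> f g \<in> sorted_fns r n \<pi> (r * j * k + j + k)"
proof -
  have \<sigma>: "\<sigma> \<in> colored_perms r n" and \<tau>: "\<tau> \<in> colored_perms r n" and \<pi>: "\<sigma> \<circ> \<tau> = \<pi>"
    using assms by (auto simp: factorizations_def)
  have f: "f l \<le> r * j" and g: "g l \<le> r * k" if "l \<in> {1..n}" for l
    using assms(3,4) that by (auto simp: sorted_fns_def)
  have "sorts r n \<pi> (merge (r * j + 1) n \<sigma> f g)"
    unfolding \<pi>[symmetric]
    by (rule sorts_comp[where f = f and g = g and j = j, OF r \<sigma> \<tau>])
       (use assms(3,4) f merge_val[OF \<sigma> r] in \<open>auto simp: sorted_fns_def\<close>)
  moreover have "merge (r * j + 1) n \<sigma> f g l \<le> r * (r * j * k + j + k)" if l: "l \<in> {1..n}" for l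
  proof -
    have "inv_into {1..n} (val \<sigma>) l \<in> {1..n}"
      using bij_betwE[OF bij_betw_inv_into[OF bij_betw_val[OF \<sigma> r]]] l by blast
    then have "merge (r * j + 1) n \<sigma> f g l \<le> (r * j + 1) * (r * k) + r * j"
      using f g l by (simp add: merge_def add_mono mult_le_mono del: mult_Suc)
    also have "\<dots> = r * (r * j * k + j + k)"
      by (simp add: algebra_simps)
    finally show ?thesis .
  qed
  ultimately show ?thesis
    by (auto simp: sorted_fns_def merge_def)
qed

text \<open>The order of recovery matters: remainders give \<open>f\<close> without knowing
  \<sigma>, \<open>f\<close> determines \<sigma>, the quotients read along \<sigma> give
  \<open>g\<close>, and \<open>g\<close> determines \<tau>.\<close>

lemma merge_inject:
  assumes r: "r \<ge> 1" and "(\<sigma>, \<tau>) \<in> factorizations r n \<pi>" "(\<sigma>', \<tau>') \<in> factorizations r n \<pi>"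
    and f: "f \<in> sorted_fns r n \<sigma> j" "f' \<in> sorted_fns r n \<sigma>' j"
    and g: "g \<in> sorted_fns r n \<tau> k" "g' \<in> sorted_fns r n \<tau>' k"
    and eq: "merge (r * j + 1) n \<sigma> f g = merge (r * j + 1) n \<sigma>' f' g'"
  shows "\<sigma> = \<sigma>' \<and> \<tau> = \<tau>' \<and> f = f' \<and> g = g'"
proof -
  have in_G: "\<sigma> \<in> colored_perms r n" "\<tau> \<in> colored_perms r n" "\<sigma>' \<in> colored_perms r n"
    "\<tau>' \<in> colored_perms r n"
    using assms(2,3) by (auto simp: factorizations_def)
  have mod: "merge (r * j + 1) n \<sigma> f g l mod (r * j + 1) = f l"
    if "f \<in> sorted_fns r n \<sigma> j" "l \<in> {1..n}" for \<sigma> f g l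
  proof -
    have "f l < r * j + 1"
      using that by (auto simp: sorted_fns_def less_Suc_eq_le)
    then show ?thesis
      using that(2) by (simp add: merge_def del: mult_Suc)
  qed
  have "f l = f' l" if "l \<in> {1..n}" for l
    using mod[OF f(1) that] mod[OF f(2) that] eq by metis
  then have "f = f'"
    using f by (intro extensionalityI[of _ "{1..n}"]) (auto simp: sorted_fns_def PiE_def)
  then have "\<sigma> = \<sigma>'"
    using f in_G by (auto simp: sorted_fns_def intro: sorts_unique[OF r])
  have "g m = g' m" if "m \<in> {1..n}" for m
  proof -
    have "(r * j + 1) * g m = (r * j + 1) * g' m"
      using merge_val[OF in_G(1) r that, of "r * j + 1" f g]
        merge_val[OF in_G(1) r that, of "r * j + 1" f g'] eq \<open>f = f'\<close> \<open>\<sigma> = \<sigma>'\<close> by simp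
    then show ?thesis
      by (simp only: mult_cancel1) simp
  qed
  then have "g = g'"
    using g by (intro extensionalityI[of _ "{1..n}"]) (auto simp: sorted_fns_def PiE_def)
  then have "\<tau> = \<tau>'"
    using g in_G by (auto simp: sorted_fns_def intro: sorts_unique[OF r])
  with \<open>f = f'\<close> \<open>\<sigma> = \<sigma>'\<close> \<open>g = g'\<close> show ?thesis by simp
qed

text \<open>Division with remainder yields \<open>f\<close>, then \<sigma> sorting it, then
  \<open>g\<close> and \<tau>. Since both \<sigma>\<tau> and \<pi> sort \<open>h\<close>, they
  agree.\<close>

lemma merge_surj:
  assumes r: "r \<ge> 1" and \<pi>: "\<pi> \<in> colored_perms r n"
    and h: "h \<in> sorted_fns r n \<pi> (r * j * k + j + k)"
  obtains \<sigma> \<tau> f g where "(\<sigma>, \<tau>) \<in> factorizations r n \<pi>" "f \<in> sorted_fns r n \<sigma> j"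
    "g \<in> sorted_fns r n \<tau> k" "h = merge (r * j + 1) n \<sigma> f g"
proof -
  define b where "b = r * j + 1"
  define f where "f = (\<lambda>l\<in>{1..n}. h l mod b)"
  obtain \<sigma> where \<sigma>: "\<sigma> \<in> colored_perms r n" "sorts r n \<sigma> f"
    by (rule sorts_exists[OF r])
  define g where "g = (\<lambda>m\<in>{1..n}. h (val \<sigma> m) div b)"
  obtain \<tau> where \<tau>: "\<tau> \<in> colored_perms r n" "sorts r n \<tau> g"
    by (rule sorts_exists[OF r])
  have h_le: "h l \<le> r * (r * j * k + j + k)" if "l \<in> {1..n}" for l
    using h that by (auto simp: sorted_fns_def)
  have f_le: "f l \<le> r * j" if "l \<in> {1..n}" for l
  proof -
    have "h l mod b < b" by (simp add: b_def)
    then show ?thesis using that by (simp add: f_def b_def)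
  qed
  have g_le: "g m \<le> r * k" if "m \<in> {1..n}" for m
  proof -
    \<comment> \<open>The right-hand side is exactly one more than the bound on
      \<open>h\<close>.\<close>
    have "h (val \<sigma> m) < (r * k + 1) * b"
      using h_le[OF val_in[OF \<sigma>(1) that r]] by (simp add: b_def algebra_simps)
    then have "h (val \<sigma> m) div b < r * k + 1"
      by (rule less_mult_imp_div_less)
    then show ?thesis using that by (simp add: g_def)
  qed
  have hval: "h (val \<sigma> m) = b * g m + f (val \<sigma> m)" if "m \<in> {1..n}" for m
    using that val_in[OF \<sigma>(1) that r] by (simp add: f_def g_def)
  have "sorts r n (\<sigma> \<circ> \<tau>) h"
    by (rule sorts_comp[OF r \<sigma>(1) \<tau>(1) \<sigma>(2) \<tau>(2) f_le hval[unfolded b_def]])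
  then have "\<sigma> \<circ> \<tau> = \<pi>"
    using h \<pi> colored_perms_comp[OF \<sigma>(1) \<tau>(1) r]
    by (auto simp: sorted_fns_def intro: sorts_unique[OF r])
  moreover have "h = merge b n \<sigma> f g"
  proof (rule extensionalityI[of _ "{1..n}"])
    fix l assume "l \<in> {1..n}"
    then have "l \<in> val \<sigma> ` {1..n}"
      using bij_betw_val[OF \<sigma>(1) r] by (simp add: bij_betw_def)
    then obtain m where "m \<in> {1..n}" "l = val \<sigma> m"
      by blast
    then show "h l = merge b n \<sigma> f g l"
      using hval merge_val[OF \<sigma>(1) r] by simp
  qed (use h in \<open>auto simp: sorted_fns_def PiE_def merge_def\<close>)
  moreover have "f \<in> sorted_fns r n \<sigma> j" "g \<in> sorted_fns r n \<tau> k"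
    using \<sigma> \<tau> f_le g_le by (auto simp: sorted_fns_def f_def g_def)
  ultimately show thesis
    using that \<sigma>(1) \<tau>(1) by (auto simp: factorizations_def b_def)
qed

text \<open>Both sides count the functions with bound \<open>r * (r * j * k + j + k)\<close> sorted
  by \<pi>: on the left they are split by \<open>merge\<close> according to the factorization they
  induce.\<close>

lemma sum_factorizations_binomial:
  assumes r: "r \<ge> 1" and \<pi>: "\<pi> \<in> colored_perms r n"
  shows "(\<Sum>(\<sigma>, \<tau>)\<in>factorizations r n \<pi>.
      ((j + n - des n \<sigma>) choose n) * ((k + n - des n \<tau>) choose n))
    = (r * j * k + j + k + n - des n \<pi>) choose n"
proof -
  define B where "B = (\<lambda>(\<sigma>, \<tau>). sorted_fns r n \<sigma> j \<times> sorted_fns r n \<tau> k)"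
  define M where "M = (\<lambda>((\<sigma>, \<tau> :: letter \<Rightarrow> letter), (f, g)). merge (r * j + 1) n \<sigma> f g)"
  have fin: "finite (factorizations r n \<pi>)"
    unfolding factorizations_def by (rule finite_factorizations)
  have "bij_betw M (Sigma (factorizations r n \<pi>) B) (sorted_fns r n \<pi> (r * j * k + j + k))"
    unfolding bij_betw_def
  proof (intro conjI equalityI subsetI)
    show "inj_on M (Sigma (factorizations r n \<pi>) B)"
      by (rule inj_onI) (auto simp: M_def B_def dest: merge_inject[OF r])
    show "h \<in> sorted_fns r n \<pi> (r * j * k + j + k)"
      if "h \<in> M ` Sigma (factorizations r n \<pi>) B" for h
      using that merge_in_sorted_fns[OF r] by (auto simp: M_def B_def)
    show "h \<in> M ` Sigma (factorizations r n \<pi>) B"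
      if h: "h \<in> sorted_fns r n \<pi> (r * j * k + j + k)" for h
    proof -
      obtain \<sigma> \<tau> f g where "(\<sigma>, \<tau>) \<in> factorizations r n \<pi>" "f \<in> sorted_fns r n \<sigma> j"
        "g \<in> sorted_fns r n \<tau> k" "h = merge (r * j + 1) n \<sigma> f g"
        by (rule merge_surj[OF r \<pi> h])
      then have "((\<sigma>, \<tau>), (f, g)) \<in> Sigma (factorizations r n \<pi>) B" "h = M ((\<sigma>, \<tau>), (f, g))"
        by (auto simp: B_def M_def)
      then show ?thesis by blast
    qed
  qed
  then have "card (Sigma (factorizations r n \<pi>) B) = (r * j * k + j + k + n - des n \<pi>) choose n"
    by (simp add: bij_betw_same_card card_sorted_fns[OF \<pi> r])
  moreover have "card (Sigma (factorizations r n \<pi>) B) = (\<Sum>x\<in>factorizations r n \<pi>. card (B x))"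
    using fin by (intro card_SigmaI)
      (auto simp: B_def factorizations_def intro!: finite_cartesian_product finite_sorted_fns[OF _ r])
  moreover have "\<dots> = (\<Sum>(\<sigma>, \<tau>)\<in>factorizations r n \<pi>.
      ((j + n - des n \<sigma>) choose n) * ((k + n - des n \<tau>) choose n))"
    by (rule sum.cong)
       (auto simp: B_def factorizations_def card_cartesian_product card_sorted_fns[OF _ r])
  ultimately show ?thesis by simp
qed

section \<open>From coefficients to the quotient of series\<close>

lemma double_series_sum:
  "double_series (\<lambda>j k. \<Sum>x\<in>A. a x j k) = (\<Sum>x\<in>A. double_series (a x))"
  by (intro fps_ext) (simp add: double_series_def fps_sum_nth)

theorem theorem3p5p6:
  fixes r n :: nat and \<pi> :: "letter \<Rightarrow> letter"
  assumes "r \<ge> 1" and "n \<ge> 1"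
    and "\<pi> \<in> colored_perms r n"
  shows "double_series (\<lambda>j k. of_nat ((r * j * k + j + k + n - des n \<pi>) choose n)) =
    (\<Sum>(\<sigma>, \<tau>) \<in> {(\<sigma>, \<tau>). \<sigma> \<in> colored_perms r n \<and> \<tau> \<in> colored_perms r n \<and> \<sigma> \<circ> \<tau> = \<pi>}.
        var_s ^ des n \<sigma> * var_t ^ des n \<tau>)
      / ((1 - var_s) ^ (n + 1) * (1 - var_t) ^ (n + 1))"
proof -
  define c :: "nat \<Rightarrow> nat \<Rightarrow> nat \<Rightarrow> nat \<Rightarrow> rat" where
    "c = (\<lambda>p q j k. of_nat ((j + n - p) choose n) * of_nat ((k + n - q) choose n))"
  define d where "d = (1 - var_s) ^ (n + 1) * (1 - var_t) ^ (n + 1)"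
  define D where
    "D = double_series (\<lambda>j k. of_nat ((r * j * k + j + k + n - des n \<pi>) choose n))"
  have c: "double_series (c p q) * d = var_s ^ p * var_t ^ q" if "p \<le> n" "q \<le> n" for p q
    unfolding c_def d_def by (rule double_series_binomials_mult[OF that])
  \<comment> \<open>The case \<open>p = q = 0\<close> exhibits an inverse of
    \<open>d\<close>.\<close>
  have "d \<noteq> 0"
    using c[of 0 0] by auto
  have "of_nat ((r * j * k + j + k + n - des n \<pi>) choose n)
      = (\<Sum>x\<in>factorizations r n \<pi>. c (des n (fst x)) (des n (snd x)) j k)" for j k
    unfolding sum_factorizations_binomial[OF assms(1,3), symmetric]
    by (simp add: c_def case_prod_unfold)
  then have "D = (\<Sum>x\<in>factorizations r n \<pi>. double_series (c (des n (fst x)) (des n (snd x))))"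
    by (simp add: D_def double_series_sum)
  then have "D * d = (\<Sum>x\<in>factorizations r n \<pi>. var_s ^ des n (fst x) * var_t ^ des n (snd x))"
    by (simp add: sum_distrib_right c des_le)
  \<comment> \<open>\<open>divide_denominator\<close> gives \<open>D * d / d * d = D * d\<close>,
    and the nonzero factor \<open>d\<close> cancels.\<close>
  moreover have "D * d / d = D"
    using divide_denominator[of "D * d" "n + 1" "n + 1", folded d_def] \<open>d \<noteq> 0\<close> by simp
  ultimately show ?thesis
    by (simp add: D_def d_def factorizations_def case_prod_unfold)
qed

end
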